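(* Let $q_{n,\mathbf{m}} := \frac{\prod_{i=1}^n m_i}{\max_{i} m_i}$. Then $$\lim_{q_{n,\mathbf{m}}\to\infty}\Pr\left[\text{the clockwork best-response dynamic on } G_{n,\mathbf{m}} \text{ converges to a PNE}\right]=0,$$ i.e. for every $\varepsilon>0$ there is $Q$ such that for all $n\ge 2$ and all $\mathbf{m}=(m_1,\dots,m_n)$ with $m_i\ge 2$ and $q_{n,\mathbf{m}}\ge Q$, this probability is less than $\varepsilon$.
   Context: A random game $G_{n,\mathbf{m}}$ has $n\ge 2$ players; player $i$ has action set $[m_i]=\{1,\dots,m_i\}$ with $m_i\ge 2$; $\mathcal{M}=\times_{i=1}^n[m_i]$. For each player $i$ and profile $\mathbf{a}\in\mathcal{M}$ the payoff $U_i(\mathbf{a})$ is drawn from a fixed atomless probability distribution on $\mathbb{R}$, independently across all $i$ and $\mathbf{a}$. For an environment $\mathbf{a}_{-i}\in\times_{j\neq i}[m_j]$, the best response $B_i(\mathbf{a}_{-i})=\arg\max_{x\in[m_i]}U_i(x,\mathbf{a}_{-i})$ is almost surely unique. A pure Nash equilibrium (PNE) is a profile $\mathbf{a}$ with $a_i=B_i(\mathbf{a}_{-i})$ for all $i$. The clockwork playing sequence is $s_{\texttt{c}}(t)=1+((t-1)\bmod n)$, $t\in\mathbb{N}=\{1,2,\dots\}$. The clockwork best-response dynamic: draw $\mathbf{A}^0$ uniformly from $\mathcal{M}$ (independently of payoffs); for each $t\ge1$, with $i=s_{\texttt{c}}(t)$, set $A^t_j=A^{t-1}_j$ for $j\ne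 i$ and $A^t_i=B_i(\mathbf{A}^{t-1}_{-i})$. The dynamic converges to a PNE if there is a finite $t\ge 1$ such that $\mathbf{A}^t$ is a PNE of $G_{n,\mathbf{m}}$. *)

theory Defs
  imports "HOL-Probability.Probability"
begin

definition profiles :: "nat \<Rightarrow> (nat \<Rightarrow> nat) \<Rightarrow> (nat \<Rightarrow> nat) set" where
  "profiles n m = PiE {1..n} (\<lambda>i. {1..m i})"

definition payoff_index :: "nat \<Rightarrow> (nat \<Rightarrow> nat) \<Rightarrow> (nat \<times> (nat \<Rightarrow> nat)) set" where
  "payoff_index n m = {1..n} \<times> profiles n m"

text \<open>Best response of player i to the environment of profile a (only a restricted
  to players other than i matters). Ties (a null event) are broken by the least index.\<close>
definition best_resp ::
  "(nat \<Rightarrow> nat) \<Rightarrow> (nat \<times> (nat \<Rightarrow> nat) \<Rightarrow> real) \<Rightarrow> nat \<Rightarrow> (nat \<Rightarrow> nat) \<Rightarrow> nat" where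
  "best_resp m U i a =
     (LEAST x. x \<in> {1..m i} \<and> (\<forall>y\<in>{1..m i}. U (i, a(i := y)) \<le> U (i, a(i := x))))"

definition is_PNE ::
  "nat \<Rightarrow> (nat \<Rightarrow> nat) \<Rightarrow> (nat \<times> (nat \<Rightarrow> nat) \<Rightarrow> real) \<Rightarrow> (nat \<Rightarrow> nat) \<Rightarrow> bool" where
  "is_PNE n m U a \<longleftrightarrow> a \<in> profiles n m \<and> (\<forall>i\<in>{1..n}. a i = best_resp m U i a)"

definition clockwork :: "nat \<Rightarrow> nat \<Rightarrow> nat" where
  "clockwork n t = 1 + ((t - 1) mod n)"

primrec clock_dyn ::
  "nat \<Rightarrow> (nat \<Rightarrow> nat) \<Rightarrow> (nat \<times> (nat \<Rightarrow> nat) \<Rightarrow> real) \<Rightarrow> (nat \<Rightarrow> nat) \<Rightarrow> nat \<Rightarrow> (nat \<Rightarrow> nat)" where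
  "clock_dyn n m U a0 0 = a0"
| "clock_dyn n m U a0 (Suc t) =
     (let A = clock_dyn n m U a0 t; i = clockwork n (Suc t) in A(i := best_resp m U i A))"

definition converges_PNE ::
  "nat \<Rightarrow> (nat \<Rightarrow> nat) \<Rightarrow> (nat \<times> (nat \<Rightarrow> nat) \<Rightarrow> real) \<Rightarrow> (nat \<Rightarrow> nat) \<Rightarrow> bool" where
  "converges_PNE n m U a0 \<longleftrightarrow> (\<exists>t\<ge>1. is_PNE n m U (clock_dyn n m U a0 t))"

definition game_space ::
  "nat \<Rightarrow> (nat \<Rightarrow> nat) \<Rightarrow> real measure \<Rightarrow> ((nat \<times> (nat \<Rightarrow> nat) \<Rightarrow> real) \<times> (nat \<Rightarrow> nat)) measure" where
  "game_space n m D = PiM (payoff_index n m) (\<lambda>_. D) \<Otimes>\<^sub>M measure_pmf (pmf_of_set (profiles n m))"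

definition conv_event ::
  "nat \<Rightarrow> (nat \<Rightarrow> nat) \<Rightarrow> real measure \<Rightarrow> ((nat \<times> (nat \<Rightarrow> nat) \<Rightarrow> real) \<times> (nat \<Rightarrow> nat)) set" where
  "conv_event n m D = {\<omega> \<in> space (game_space n m D). converges_PNE n m (fst \<omega>) (snd \<omega>)}"

definition q_nm :: "nat \<Rightarrow> (nat \<Rightarrow> nat) \<Rightarrow> real" where
  "q_nm n m = (\<Prod>i\<in>{1..n}. real (m i)) / real (Max (m ` {1..n}))"

end

theory Submission
  imports Defs "HOL-Real_Asymp.Real_Asymp"
begin

text \<open>
  As long as no player meets the same environment twice, the best responses along the dynamic are
  independent and uniform, so a set of repetition-free move sequences is at most as likely as under
  uniformly random moves. If a PNE is first reached at time \<open>t\<close>, then no environment is repeated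
  before step \<open>t + n - 1\<close> (a repetition makes the trajectory periodic, so the PNE would have been
  reached earlier), and the \<open>n - 1\<close> moves that follow \<open>t\<close> are forced; this has probability at most
  \<open>1 / q\<close>. On the other hand, the environment of a player with the largest number of actions is
  refreshed completely in every round, so the absence of repetitions during \<open>k\<close> rounds is a birthday
  event among \<open>q\<close> environments, of probability at most \<open>exp (- (k choose 2) / q)\<close>. Since
  \<open>n \<le> 1 + log 2 q\<close>, the choice \<open>k \<approx> q powr (2/3)\<close> makes both \<open>n (k + 1) / q\<close> and the birthday
  bound vanish.
\<close>

section \<open>Maxima of independent samples\<close>

lemma ex_argmax_finite:
  fixes f :: "'a \<Rightarrow> 'b :: linorder"
  assumes "finite A" "A \<noteq> {}"
  shows "\<exists>x\<in>A. \<forall>y\<in>A. f y \<le> f x"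
proof -
  have "Max (f ` A) \<in> f ` A" using assms by (intro Max_in) auto
  then obtain x where "x \<in> A" "f x = Max (f ` A)" by force
  then show ?thesis using assms(1) by (intro bexI[of _ x]) auto
qed

lemma (in prob_space) indep_vars_imp_indep_var:
  assumes "indep_vars M' X I" "i \<in> I" "j \<in> I" "i \<noteq> j"
  shows "indep_var (M' i) (X i) (M' j) (X j)"
proof -
  have "indep_var (PiM {i} M') (\<lambda>\<omega>. restrict (\<lambda>i. X i \<omega>) {i})
      (PiM {j} M') (\<lambda>\<omega>. restrict (\<lambda>i. X i \<omega>) {j})"
    using assms by (intro indep_var_restrict) auto
  then have "indep_var (M' i) ((\<lambda>y. y i) \<circ> (\<lambda>\<omega>. restrict (\<lambda>i. X i \<omega>) {i}))
      (M' j) ((\<lambda>y. y j) \<circ> (\<lambda>\<omega>. restrict (\<lambda>i. X i \<omega>) {j}))"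
    by (rule indep_var_compose) auto
  then show ?thesis
    by (simp add: comp_def)
qed

lemma (in prob_space) AE_indep_var_neq:
  fixes X Y :: "'a \<Rightarrow> 'b :: {second_countable_topology, t2_space}"
  assumes indep: "indep_var borel X borel Y"
    and atomless: "\<And>x. emeasure (distr M borel X) {x} = 0"
  shows "AE \<omega> in M. X \<omega> \<noteq> Y \<omega>"
proof -
  have [measurable]: "random_variable borel X" "random_variable borel Y"
    and joint: "distr M (borel \<Otimes>\<^sub>M borel) (\<lambda>\<omega>. (X \<omega>, Y \<omega>)) =
      distr M borel X \<Otimes>\<^sub>M distr M borel Y"
    using indep by (auto simp: indep_var_distribution_eq)
  interpret X: prob_space "distr M borel X" by (rule prob_space_distr) simp
  interpret Y: prob_space "distr M borel Y" by (rule prob_space_distr) simp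
  interpret pair_prob_space "distr M borel X" "distr M borel Y" ..
  let ?diagonal = "{z :: 'b \<times> 'b. fst z = snd z}"
  have sets_diagonal: "?diagonal \<in> sets (borel \<Otimes>\<^sub>M borel)"
    using measurable_equality_set[OF measurable_fst measurable_snd]
    by (simp add: space_pair_measure)
  have "emeasure M {\<omega> \<in> space M. X \<omega> = Y \<omega>} =
      emeasure (distr M (borel \<Otimes>\<^sub>M borel) (\<lambda>\<omega>. (X \<omega>, Y \<omega>))) ?diagonal"
    by (subst emeasure_distr) (auto intro!: arg_cong[where f = "emeasure M"] sets_diagonal)
  also have "\<dots> = emeasure (distr M borel X \<Otimes>\<^sub>M distr M borel Y) ?diagonal"
    by (simp only: joint)
  also have "\<dots> = (\<integral>\<^sup>+ y. emeasure (distr M borel X) {y} \<partial>distr M borel Y)"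
    using sets_diagonal by (subst emeasure_pair_measure_alt2) (auto simp: vimage_def)
  also have "\<dots> = 0" by (simp add: atomless)
  finally show ?thesis
    by (intro AE_I[of _ _ "{\<omega> \<in> space M. X \<omega> = Y \<omega>}"]) auto
qed

lemma indep_vars_PiM_components:
  assumes "\<And>i. i \<in> I \<Longrightarrow> prob_space (M i)"
  shows "prob_space.indep_vars (PiM I M) M (\<lambda>i \<omega>. \<omega> i) I"
proof -
  interpret prob_space "PiM I M" using assms by (rule prob_space_PiM)
  show ?thesis
  proof (cases "I = {}")
    case True
    then show ?thesis unfolding indep_vars_def indep_sets_def by simp
  next
    case False
    have "distr (PiM I M) (PiM I M) (\<lambda>\<omega>. restrict \<omega> I) = distr (PiM I M) (PiM I M) (\<lambda>\<omega>. \<omega>)"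
      by (intro distr_cong) (auto simp: space_PiM PiE_iff extensional_restrict)
    also have "\<dots> = PiM I (\<lambda>i. distr (PiM I M) (M i) (\<lambda>\<omega>. \<omega> i))"
      using assms by (simp add: distr_PiM_component distr_id cong: PiM_cong)
    finally show ?thesis using False by (subst indep_vars_iff_distr_eq_PiM') auto
  qed
qed

locale atomless_distribution = real_distribution D for D :: "real measure" +
  assumes atomless: "emeasure D {x} = 0"
begin

abbreviation iid :: "'i set \<Rightarrow> ('i \<Rightarrow> real) measure" where
  "iid I \<equiv> PiM I (\<lambda>_. D)"

lemma prob_space_iid: "prob_space (iid I)"
  by (intro prob_space_PiM prob_space_axioms)

lemma indep_vars_iid: "prob_space.indep_vars (iid I) (\<lambda>_. D) (\<lambda>i x. x i) I"
  by (intro indep_vars_PiM_components prob_space_axioms)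

lemma AE_iid_neq:
  assumes "i \<in> I" "j \<in> I" "i \<noteq> j"
  shows "AE x in iid I. x i \<noteq> x j"
proof -
  interpret iid: prob_space "iid I" by (rule prob_space_iid)
  have "iid.indep_vars (\<lambda>_. borel) (\<lambda>i x. x i) I"
    by (rule iid.indep_vars_compose2[OF indep_vars_iid]) simp
  then have "iid.indep_var borel (\<lambda>x. x i) borel (\<lambda>x. x j)"
    using assms by (intro iid.indep_vars_imp_indep_var)
  moreover have "distr (iid I) borel (\<lambda>x. x i) = distr (iid I) D (\<lambda>x. x i)"
    by (intro distr_cong) auto
  then have "distr (iid I) borel (\<lambda>x. x i) = D"
    using distr_PiM_component[of I "\<lambda>_. D" i] assms(1) prob_space_axioms by simp
  ultimately show ?thesis
    using atomless by (intro iid.AE_indep_var_neq) auto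
qed

lemma sets_iid_max:
  assumes "K \<subseteq> I" "finite K" "i \<in> K"
  shows "{x \<in> space (iid I). \<forall>j\<in>K. x j \<le> x i} \<in> sets (iid I)"
proof -
  have "(\<lambda>x. x j) \<in> borel_measurable (iid I)" if "j \<in> K" for j
    using that assms(1) measurable_component_singleton[of j I "\<lambda>_. D"] by auto
  then have "Measurable.pred (iid I) (\<lambda>x. \<forall>j\<in>K. x j \<le> x i)"
    using assms by (intro pred_intros_finite) (auto simp: pred_def intro!: borel_measurable_le)
  then show ?thesis by (simp add: pred_def)
qed

lemma prob_iid_max_exchange:
  assumes "K \<subseteq> I" "finite K" "i \<in> K" "k \<in> K"
  shows "\<P>(x in iid I. \<forall>j\<in>K. x j \<le> x i) = \<P>(x in iid I. \<forall>j\<in>K. x j \<le> x k)"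
proof -
  let ?\<tau> = "Transposition.transpose i k"
  let ?swap = "\<lambda>x. \<lambda>j\<in>I. x (?\<tau> j)"
  let ?max_k = "{x \<in> space (iid I). \<forall>j\<in>K. x j \<le> x k}"
  have \<tau>_image: "?\<tau> ` K = K" using assms by (intro transpose_image_eq) auto
  have \<tau>_in: "?\<tau> j \<in> I" if "j \<in> I" for j
    using that assms by (auto simp: Transposition.transpose_def)
  have swap: "?swap \<in> iid I \<rightarrow>\<^sub>M iid I"
    using \<tau>_in by (intro measurable_restrict) auto
  have "distr (iid I) (iid I) ?swap = iid I"
    using \<tau>_in by (intro distr_PiM_reindex[of I "\<lambda>_. D", simplified] prob_space_axioms) auto
  then have "measure (iid I) ?max_k = measure (iid I) (?swap -` ?max_k \<inter> space (iid I))"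
    using measure_distr[OF swap, of ?max_k] sets_iid_max[of K I k] assms by simp
  also have "?swap -` ?max_k \<inter> space (iid I) = {x \<in> space (iid I). \<forall>j\<in>K. x j \<le> x i}"
  proof -
    have "(\<forall>j\<in>K. x (?\<tau> j) \<le> x i) \<longleftrightarrow> (\<forall>j\<in>K. x j \<le> x i)" for x :: "_ \<Rightarrow> real"
      by (subst (2) \<tau>_image[symmetric]) simp
    then show ?thesis using assms measurable_space[OF swap] by (auto simp: subset_iff)
  qed
  finally show ?thesis by simp
qed

lemma prob_iid_max:
  assumes "K \<subseteq> I" "finite K" "i \<in> K"
  shows "\<P>(x in iid I. \<forall>j\<in>K. x j \<le> x i) = 1 / card K"
proof -
  interpret iid: prob_space "iid I" by (rule prob_space_iid)
  define max_at where "max_at k = {x \<in> space (iid I). \<forall>j\<in>K. x j \<le> x k}" for k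
  have sets_max_at: "max_at k \<in> sets (iid I)" if "k \<in> K" for k
    unfolding max_at_def using that assms by (intro sets_iid_max) auto
  have "AE x in iid I. x \<notin> max_at k \<or> x \<notin> max_at l" if "k \<in> K" "l \<in> K" "k \<noteq> l" for k l
    using AE_iid_neq[of k I l] that assms(1) by (force simp: max_at_def elim!: eventually_mono)
  then have "measure (iid I) (\<Union>k\<in>K. max_at k) = (\<Sum>k\<in>K. measure (iid I) (max_at k))"
    using sets_max_at assms(2)
    by (intro measure_UNION_AE) (auto simp: pairwise_def iid.fmeasurable_eq_sets)
  also have "\<dots> = (\<Sum>k\<in>K. measure (iid I) (max_at i))"
    unfolding max_at_def using assms by (intro sum.cong prob_iid_max_exchange) auto
  also have "(\<Union>k\<in>K. max_at k) = space (iid I)"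
  proof -
    have "\<exists>k\<in>K. \<forall>j\<in>K. x j \<le> x k" for x :: "_ \<Rightarrow> real"
      using assms(2,3) by (intro ex_argmax_finite) auto
    then show ?thesis by (auto simp: max_at_def)
  qed
  finally have "card K * measure (iid I) (max_at i) = 1" by (simp add: iid.prob_space)
  moreover have "card K \<noteq> 0" using assms(2,3) by auto
  ultimately show ?thesis by (simp add: max_at_def field_simps)
qed

lemma prob_iid_disjoint_max:
  assumes finite: "finite C" "\<And>c. c \<in> C \<Longrightarrow> finite (K c)"
    and disjoint: "disjoint_family_on K C"
    and subset: "\<And>c. c \<in> C \<Longrightarrow> K c \<subseteq> I"
    and in_K: "\<And>c. c \<in> C \<Longrightarrow> v c \<in> K c"
  shows "\<P>(x in iid I. \<forall>c\<in>C. \<forall>j\<in>K c. x j \<le> x (v c)) = 1 / (\<Prod>c\<in>C. card (K c))"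
proof (cases "C = {}")
  case True
  then show ?thesis using prob_space.prob_space[OF prob_space_iid, of I] by simp
next
  case False
  interpret iid: prob_space "iid I" by (rule prob_space_iid)
  define max_in where "max_in c = {x \<in> space (iid I). \<forall>j\<in>K c. x j \<le> x (v c)}" for c
  have "iid.indep_vars (\<lambda>c. iid (K c)) (\<lambda>c x. restrict x (K c)) C"
    using subset disjoint by (intro iid.indep_vars_restrict[OF indep_vars_iid])
  then have "iid.indep_events (\<lambda>c. {x \<in> space (iid I).
      \<forall>j\<in>K c. restrict x (K c) j \<le> restrict x (K c) (v c)}) C"
    (is "iid.indep_events ?max_in C")
    by (rule iid.indep_eventsI_indep_vars) (use finite in_K in \<open>auto intro!: sets_iid_max\<close>)
  then have "measure (iid I) (\<Inter>c\<in>C. ?max_in c) = (\<Prod>c\<in>C. measure (iid I) (?max_in c))"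
    using finite(1) False unfolding iid.indep_events_def by blast
  moreover have "?max_in c = max_in c" if "c \<in> C" for c
    using in_K[OF that] by (auto simp: max_in_def)
  ultimately have "measure (iid I) (\<Inter>c\<in>C. max_in c) = (\<Prod>c\<in>C. measure (iid I) (max_in c))"
    by (simp cong: INF_cong prod.cong)
  also have "\<dots> = (\<Prod>c\<in>C. 1 / card (K c))"
    unfolding max_in_def using finite subset in_K by (intro prod.cong prob_iid_max) auto
  also have "(\<Inter>c\<in>C. max_in c) = {x \<in> space (iid I). \<forall>c\<in>C. \<forall>j\<in>K c. x j \<le> x (v c)}"
    using False by (auto simp: max_in_def)
  finally show ?thesis by (simp add: prod_dividef)
qed

end

lemma (in prob_space) measure_pair_pmf_le:
  assumes sets: "S \<in> sets (M \<Otimes>\<^sub>M measure_pmf p)"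
    and slice_le: "\<And>y. y \<in> set_pmf p \<Longrightarrow> \<P>(x in M. (x, y) \<in> S) \<le> b"
  shows "measure (M \<Otimes>\<^sub>M measure_pmf p) S \<le> b"
proof -
  have emeasure_slice_le: "emeasure M {x \<in> space M. (x, y) \<in> S} \<le> ennreal b"
    if "y \<in> set_pmf p" for y
    using slice_le[OF that] by (simp add: emeasure_eq_measure ennreal_leI)
  interpret pair_prob_space M "measure_pmf p" ..
  obtain y where "y \<in> set_pmf p" using set_pmf_not_empty by fast
  then have b_nonneg: "0 \<le> b" using slice_le measure_nonneg order_trans by blast
  have slice: "(\<lambda>x. (x, y)) -` S = {x \<in> space M. (x, y) \<in> S}" for y
    using sets.sets_into_space[OF sets] by (auto simp: space_pair_measure)
  have "emeasure (M \<Otimes>\<^sub>M measure_pmf p) S =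
      (\<integral>\<^sup>+ y. emeasure M {x \<in> space M. (x, y) \<in> S} \<partial>measure_pmf p)"
    unfolding emeasure_pair_measure_alt2[OF sets] slice ..
  also have "\<dots> \<le> ennreal b"
    using emeasure_slice_le
    by (intro subprob_space.nn_integral_le_const measure_pmf.subprob_space_axioms)
      (auto simp: AE_measure_pmf_iff)
  finally show ?thesis unfolding measure_def using b_nonneg by (simp add: enn2real_leI)
qed

section \<open>A birthday bound\<close>

lemma card_avoiding_fibres_le:
  assumes finite_A: "finite A"
    and fibre: "\<And>a. a \<in> A \<Longrightarrow> d \<le> card {b \<in> A. f b = f a}"
    and S: "S \<subseteq> f ` A"
  shows "real (card {a \<in> A. f a \<notin> S}) \<le> card A - real d * card S"
proof -
  have finite_S: "finite S" using finite_A S finite_surj by blast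
  have "card S * d \<le> (\<Sum>s\<in>S. card {a \<in> A. f a = s})"
    using S fibre by (intro sum_bounded_below[where K = d, simplified]) auto
  also have "\<dots> = card (\<Union>s\<in>S. {a \<in> A. f a = s})"
    using finite_A finite_S by (intro card_UN_disjoint[symmetric]) auto
  also have "(\<Union>s\<in>S. {a \<in> A. f a = s}) = A - {a \<in> A. f a \<notin> S}" by auto
  also have "card \<dots> = card A - card {a \<in> A. f a \<notin> S}"
    using finite_A by (intro card_Diff_subset) auto
  finally have "card S * d + card {a \<in> A. f a \<notin> S} \<le> card A"
    using finite_A card_mono[of A "{a \<in> A. f a \<notin> S}"] by auto
  then have "real (card S * d + card {a \<in> A. f a \<notin> S}) \<le> card A"
    by (rule of_nat_mono)
  then show ?thesis by (simp add: mult.commute)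
qed

definition inj_seqs :: "'a set \<Rightarrow> ('a \<Rightarrow> 'b) \<Rightarrow> nat \<Rightarrow> (nat \<Rightarrow> 'a) set" where
  "inj_seqs A f k = {x \<in> {..<k} \<rightarrow>\<^sub>E A. inj_on (f \<circ> x) {..<k}}"

lemma finite_inj_seqs: "finite A \<Longrightarrow> finite (inj_seqs A f k)"
  unfolding inj_seqs_def by (intro finite_subset[OF _ finite_PiE[of "{..<k}" "\<lambda>_. A"]]) auto

lemma card_inj_seqs_extension_le:
  assumes "finite A"
    and "\<And>a. a \<in> A \<Longrightarrow> d \<le> card {b \<in> A. f b = f a}"
    and x: "x \<in> inj_seqs A f k"
  shows "real (card {a \<in> A. f a \<notin> f ` x ` {..<k}}) \<le> card A * exp (- (real d * k / card A))"
proof -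
  have "f ` x ` {..<k} \<subseteq> f ` A" using x by (auto simp: inj_seqs_def)
  moreover have "card (f ` x ` {..<k}) = k"
    using x card_image[of "f \<circ> x" "{..<k}"] by (simp add: inj_seqs_def image_comp)
  ultimately have "real (card {a \<in> A. f a \<notin> f ` x ` {..<k}}) \<le> card A - real d * k"
    using card_avoiding_fibres_le[OF assms(1,2)] by metis
  also have "\<dots> \<le> card A * (1 + - (real d * k / card A))"
    by (cases "card A = 0") (simp_all add: algebra_simps)
  also have "\<dots> \<le> card A * exp (- (real d * k / card A))"
    by (intro mult_left_mono exp_ge_add_one_self) auto
  finally show ?thesis .
qed

lemma card_inj_seqs_Suc_le:
  fixes b :: real
  assumes finite_A: "finite A"
    and extension: "\<And>x. x \<in> inj_seqs A f k \<Longrightarrow> real (card {a \<in> A. f a \<notin> f ` x ` {..<k}}) \<le> b"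
  shows "card (inj_seqs A f (Suc k)) \<le> card (inj_seqs A f k) * b"
proof -
  let ?split = "\<lambda>x. (restrict x {..<k}, x k)"
  let ?extensions = "SIGMA x : inj_seqs A f k. {a \<in> A. f a \<notin> f ` x ` {..<k}}"
  have "inj_on ?split (inj_seqs A f (Suc k))"
  proof (rule inj_onI)
    fix x y
    assume xy: "x \<in> inj_seqs A f (Suc k)" "y \<in> inj_seqs A f (Suc k)" and eq: "?split x = ?split y"
    then have "x i = y i" if "i < Suc k" for i
      using that by (cases "i = k") (auto dest!: fun_cong[of _ _ i])
    then show "x = y" using xy by (auto simp: inj_seqs_def intro: PiE_ext)
  qed
  moreover have "?split ` inj_seqs A f (Suc k) \<subseteq> ?extensions"
  proof (rule image_subsetI)
    fix x assume "x \<in> inj_seqs A f (Suc k)"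
    then have x: "x \<in> {..<k} \<rightarrow> A" "x k \<in> A" "inj_on (f \<circ> x) {..<Suc k}"
      by (auto simp: inj_seqs_def PiE_iff)
    then have "inj_on (f \<circ> x) {..<k}" "f (x k) \<notin> f ` x ` {..<k}"
      by (auto simp: lessThan_Suc image_comp)
    moreover from this(1) have "inj_on (f \<circ> restrict x {..<k}) {..<k}"
      by (simp add: inj_on_def)
    ultimately show "?split x \<in> ?extensions"
      using x by (simp add: inj_seqs_def)
  qed
  moreover have "finite ?extensions"
    using finite_A by (simp add: finite_inj_seqs)
  ultimately have "card (inj_seqs A f (Suc k)) \<le> card ?extensions" by (rule card_inj_on_le)
  also have "card ?extensions = (\<Sum>x\<in>inj_seqs A f k. card {a \<in> A. f a \<notin> f ` x ` {..<k}})"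
    using finite_A by (simp add: finite_inj_seqs)
  finally have "card (inj_seqs A f (Suc k)) \<le>
      (\<Sum>x\<in>inj_seqs A f k. real (card {a \<in> A. f a \<notin> f ` x ` {..<k}}))"
    by (simp flip: of_nat_sum)
  also have "\<dots> \<le> card (inj_seqs A f k) * b"
    using extension by (rule sum_bounded_above)
  finally show ?thesis .
qed

lemma card_inj_seqs_le:
  assumes finite_A: "finite A" and fibre: "\<And>a. a \<in> A \<Longrightarrow> d \<le> card {b \<in> A. f b = f a}"
  shows "card (inj_seqs A f k) \<le>
    real (card A) ^ k * exp (- (d * real (k choose 2) / card A))"
proof (induction k)
  case 0
  have "inj_seqs A f 0 = {\<lambda>_. undefined}" by (auto simp: inj_seqs_def)
  then show ?case by (simp add: numeral_2_eq_2)
next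
  case (Suc k)
  let ?N = "real (card A)"
  have "card (inj_seqs A f (Suc k)) \<le> card (inj_seqs A f k) * (?N * exp (- (real d * k / ?N)))"
    using finite_A card_inj_seqs_extension_le[OF assms] by (rule card_inj_seqs_Suc_le)
  also have "\<dots> \<le> (?N ^ k * exp (- (d * real (k choose 2) / ?N))) * (?N * exp (- (real d * k / ?N)))"
    using Suc.IH by (intro mult_right_mono) auto
  also have "\<dots> = ?N ^ Suc k * exp (- (d * real (k choose 2) / ?N) + - (real d * k / ?N))"
    unfolding exp_add by simp
  also have "- (d * real (k choose 2) / ?N) + - (real d * k / ?N) =
      - (d * real (Suc k choose 2) / ?N)"
    by (simp add: numeral_2_eq_2 algebra_simps add_divide_distrib)
  finally show ?case .
qed

section \<open>Profiles and environments\<close>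

lemma profiles_fun_upd:
  assumes "a \<in> profiles n m" "i \<in> {1..n}" "x \<in> {1..m i}"
  shows "a(i := x) \<in> profiles n m"
  using assms unfolding profiles_def by (auto simp: PiE_iff extensional_def)

lemma finite_profiles [simp]: "finite (profiles n m)"
  by (auto simp: profiles_def intro: finite_PiE)

lemma card_profiles: "card (profiles n m) = (\<Prod>i\<in>{1..n}. m i)"
  by (simp add: profiles_def card_PiE)

lemma ex_max_player:
  fixes n :: nat and m :: "nat \<Rightarrow> nat"
  assumes "0 < n"
  shows "\<exists>i\<in>{1..n}. m i = Max (m ` {1..n})"
proof -
  have "Max (m ` {1..n}) \<in> m ` {1..n}" using assms by (intro Max_in) (auto simp: Suc_le_eq)
  then show ?thesis by force
qed

lemma q_nm_eq_prod_remove: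
  assumes "i \<in> {1..n}" "m i = Max (m ` {1..n})" "0 < m i"
  shows "q_nm n m = (\<Prod>j\<in>{1..n} - {i}. real (m j))"
  using assms prod.remove[of "{1..n}" i "\<lambda>j. real (m j)"] by (simp add: q_nm_def)

lemma q_nm_le_prod_remove:
  assumes "i \<in> {1..n}" "0 < m i"
  shows "q_nm n m \<le> (\<Prod>j\<in>{1..n} - {i}. real (m j))"
proof -
  have le_Max: "m i \<le> Max (m ` {1..n})" using assms(1) by (intro Max_ge) auto
  have "(\<Prod>j\<in>{1..n}. real (m j)) = m i * (\<Prod>j\<in>{1..n} - {i}. real (m j))"
    using assms(1) by (intro prod.remove) auto
  also have "\<dots> \<le> Max (m ` {1..n}) * (\<Prod>j\<in>{1..n} - {i}. real (m j))"
    using le_Max by (intro mult_right_mono prod_nonneg) auto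
  finally show ?thesis
    using assms(2) le_Max by (subst q_nm_def, subst pos_divide_le_eq) (auto simp: mult.commute)
qed

lemma le_log_q_nm:
  assumes "0 < n" "\<And>i. i \<in> {1..n} \<Longrightarrow> 2 \<le> m i"
  shows "n \<le> 1 + log 2 (q_nm n m)"
proof -
  obtain i where i: "i \<in> {1..n}" "m i = Max (m ` {1..n})"
    using ex_max_player[OF assms(1)] by blast
  have "(2::real) ^ (n - 1) = (\<Prod>j\<in>{1..n} - {i}. 2)" using i(1) by simp
  also have "\<dots> \<le> (\<Prod>j\<in>{1..n} - {i}. real (m j))"
    using assms(2) by (intro prod_mono) fastforce
  also have "\<dots> = q_nm n m"
    using i assms(2)[OF i(1)] by (intro q_nm_eq_prod_remove[symmetric]) auto
  finally have "real (n - 1) \<le> log 2 (q_nm n m)" by (rule le_log_of_power) simp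
  then show ?thesis using assms(1) by simp
qed

text \<open>The action of player \<open>i\<close> is overwritten by the non-action 0, so that only the actions of the
  other players are remembered.\<close>
definition environment :: "nat \<Rightarrow> (nat \<Rightarrow> nat) \<Rightarrow> nat \<times> (nat \<Rightarrow> nat)" where
  "environment i a = (i, a(i := 0))"

definition deviations :: "(nat \<Rightarrow> nat) \<Rightarrow> nat \<Rightarrow> (nat \<Rightarrow> nat) \<Rightarrow> (nat \<times> (nat \<Rightarrow> nat)) set" where
  "deviations m i a = (\<lambda>x. (i, a(i := x))) ` {1..m i}"

lemma environment_fun_upd [simp]: "environment i (a(i := x)) = environment i a"
  by (simp add: environment_def)

lemma environment_eq_iff:
  "environment i a = environment j b \<longleftrightarrow> i = j \<and> (\<forall>k. k \<noteq> i \<longrightarrow> a k = b k)"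
  by (auto simp: environment_def fun_eq_iff)

lemma environment_eq_fun_upd: "environment i a = environment j b \<Longrightarrow> a(i := x) = b(j := x)"
  by (auto simp: environment_eq_iff)

lemma card_profiles_environment:
  assumes a: "a \<in> profiles n m" and i: "i \<in> {1..n}"
  shows "card {b \<in> profiles n m. environment i b = environment i a} = m i"
proof -
  have "{b \<in> profiles n m. environment i b = environment i a} = (\<lambda>x. a(i := x)) ` {1..m i}"
  proof (intro equalityI subsetI)
    fix b assume b: "b \<in> {b \<in> profiles n m. environment i b = environment i a}"
    then have "b = a(i := b i)" by (auto simp: environment_eq_iff)
    moreover have "b i \<in> {1..m i}" using b i by (auto simp: profiles_def)
    ultimately show "b \<in> (\<lambda>x. a(i := x)) ` {1..m i}" by (rule image_eqI)
  qed (use profiles_fun_upd[OF a i] in auto)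
  moreover have "inj_on (\<lambda>x. a(i := x)) {1..m i}"
    by (auto intro!: inj_onI dest: fun_upd_eqD)
  ultimately show ?thesis by (simp add: card_image)
qed

lemma finite_deviations [simp]: "finite (deviations m i a)"
  by (simp add: deviations_def)

lemma card_deviations: "card (deviations m i a) = m i"
proof -
  have "inj_on (\<lambda>x. (i, a(i := x))) {1..m i}"
    by (auto intro!: inj_onI dest: fun_upd_eqD)
  then show ?thesis by (simp add: deviations_def card_image)
qed

lemma deviations_subset_payoff_index:
  "a \<in> profiles n m \<Longrightarrow> i \<in> {1..n} \<Longrightarrow> deviations m i a \<subseteq> payoff_index n m"
  using profiles_fun_upd by (auto simp: deviations_def payoff_index_def)

lemma disjoint_deviations:
  assumes "environment i a \<noteq> environment j b"
  shows "deviations m i a \<inter> deviations m j b = {}"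
proof -
  have "environment (fst z) (snd z) = environment i a" if "z \<in> deviations m i a" for z i a
    using that by (auto simp: deviations_def)
  with assms show ?thesis by (metis disjoint_iff)
qed

lemma best_resp_environment_cong:
  assumes "environment i a = environment j b"
  shows "best_resp m U i a = best_resp m U j b"
proof -
  have "i = j" using assms by (simp add: environment_eq_iff)
  then show ?thesis using environment_eq_fun_upd[OF assms] by (simp add: best_resp_def)
qed

lemma
  assumes "0 < m i"
  shows best_resp_in: "best_resp m U i a \<in> {1..m i}"
    and best_resp_max: "z \<in> deviations m i a \<Longrightarrow> U z \<le> U (i, a(i := best_resp m U i a))"
proof -
  have "\<exists>x. x \<in> {1..m i} \<and> (\<forall>y\<in>{1..m i}. U (i, a(i := y)) \<le> U (i, a(i := x)))"
    using ex_argmax_finite[of "{1..m i}" "\<lambda>x. U (i, a(i := x))"] assms by (auto simp: Suc_le_eq)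
  from LeastI_ex[OF this]
  show "best_resp m U i a \<in> {1..m i}"
    and "z \<in> deviations m i a \<Longrightarrow> U z \<le> U (i, a(i := best_resp m U i a))"
    by (auto simp: best_resp_def deviations_def)
qed

section \<open>The clockwork dynamic\<close>

locale clockwork_game =
  fixes n :: nat and m :: "nat \<Rightarrow> nat"
  assumes n_pos: "0 < n" and m_pos: "i \<in> {1..n} \<Longrightarrow> 0 < m i"
begin

text \<open>Steps are numbered from 0: step \<open>t\<close> leads from the profile at time \<open>t\<close> to that at
  \<open>Suc t\<close>.\<close>
abbreviation mover :: "nat \<Rightarrow> nat" where
  "mover t \<equiv> clockwork n (Suc t)"

lemma mover_in: "mover t \<in> {1..n}"
  using n_pos by (simp add: clockwork_def Suc_le_eq)

lemma m_mover_pos: "0 < m (mover t)"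
  by (rule m_pos[OF mover_in])

lemma mover_eq_iff: "mover s = mover t \<longleftrightarrow> s mod n = t mod n"
  by (simp add: clockwork_def)

lemma mover_neq:
  assumes "s < t" "t < s + n"
  shows "mover s \<noteq> mover t"
proof
  assume "mover s = mover t"
  then have "n dvd t - s"
    using assms by (metis mover_eq_iff mod_eq_dvd_iff_nat less_imp_le)
  then show False using assms by (auto dest: dvd_imp_le)
qed

lemma bij_betw_mover: "bij_betw mover {t..<t + n} {1..n}"
proof -
  have inj: "inj_on mover {t..<t + n}"
  proof (rule linorder_inj_onI)
    fix r s assume "r < s" "r \<in> {t..<t + n}" "s \<in> {t..<t + n}"
    then show "mover r \<noteq> mover s" by (intro mover_neq) auto
  qed auto
  have "mover ` {t..<t + n} = {1..n}"
    by (rule card_subset_eq) (use mover_in card_image[OF inj] in auto)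
  with inj show ?thesis by (simp add: bij_betw_def)
qed

lemma q_nm_pos: "0 < q_nm n m"
proof -
  obtain i where i: "i \<in> {1..n}" "m i = Max (m ` {1..n})"
    using ex_max_player[OF n_pos] by blast
  show ?thesis
    unfolding q_nm_eq_prod_remove[OF i m_pos[OF i(1)]] using m_pos by (intro prod_pos) auto
qed

lemma q_nm_le_prod_mover: "q_nm n m \<le> (\<Prod>s\<in>{t..<t + n - 1}. real (m (mover s)))"
proof -
  let ?last = "t + n - 1"
  have "{t..<?last} = {t..<t + n} - {?last}" using n_pos by auto
  moreover have "bij_betw mover ({t..<t + n} - {?last}) ({1..n} - {mover ?last})"
    using bij_betw_mover mover_in[of ?last] n_pos by (intro bij_betw_DiffI) auto
  ultimately have "(\<Prod>s\<in>{t..<?last}. real (m (mover s))) =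
      (\<Prod>j\<in>{1..n} - {mover ?last}. real (m j))"
    using prod.reindex_bij_betw by fastforce
  then show ?thesis
    using q_nm_le_prod_remove[of "mover ?last" n m, OF mover_in m_mover_pos] by simp
qed

primrec play :: "(nat \<Rightarrow> nat) \<Rightarrow> (nat \<Rightarrow> nat) \<Rightarrow> nat \<Rightarrow> (nat \<Rightarrow> nat)" where
  "play a0 x 0 = a0"
| "play a0 x (Suc t) = (play a0 x t)(mover t := x t)"

definition visit :: "(nat \<Rightarrow> nat) \<Rightarrow> (nat \<Rightarrow> nat) \<Rightarrow> nat \<Rightarrow> nat \<times> (nat \<Rightarrow> nat)" where
  "visit a0 x t = environment (mover t) (play a0 x t)"

definition move_seqs :: "nat \<Rightarrow> (nat \<Rightarrow> nat) set" where
  "move_seqs T = PiE {..<T} (\<lambda>t. {1..m (mover t)})"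

definition best_moves :: "(nat \<times> (nat \<Rightarrow> nat) \<Rightarrow> real) \<Rightarrow> (nat \<Rightarrow> nat) \<Rightarrow> nat \<Rightarrow> nat" where
  "best_moves U a0 t = best_resp m U (mover t) (clock_dyn n m U a0 t)"

lemma play_best_moves: "play a0 (best_moves U a0) t = clock_dyn n m U a0 t"
  by (induction t) (simp_all add: best_moves_def Let_def)

lemma best_moves_in: "best_moves U a0 t \<in> {1..m (mover t)}"
  unfolding best_moves_def by (rule best_resp_in[of m, OF m_mover_pos])

lemma play_cong: "(\<And>s. s < t \<Longrightarrow> x s = y s) \<Longrightarrow> play a0 x t = play a0 y t"
  by (induction t) auto

lemma play_restrict [simp]: "t \<le> T \<Longrightarrow> play a0 (restrict x {..<T}) t = play a0 x t"
  by (intro play_cong) simp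

lemma inj_on_visit_restrict:
  "S \<subseteq> {..T} \<Longrightarrow> inj_on (visit a0 (restrict x {..<T})) S \<longleftrightarrow> inj_on (visit a0 x) S"
  by (intro inj_on_cong) (auto simp: visit_def)

lemma play_in_profiles:
  assumes "a0 \<in> profiles n m" "x \<in> move_seqs T" "t \<le> T"
  shows "play a0 x t \<in> profiles n m"
  using assms(3)
proof (induction t)
  case (Suc t)
  then have "x t \<in> {1..m (mover t)}" using assms(2) by (auto simp: move_seqs_def PiE_iff)
  then show ?case using Suc profiles_fun_upd[OF _ mover_in] by (simp only: play.simps Suc_leD)
qed (use assms(1) in simp)

lemma play_last_move: "t < s \<Longrightarrow> s \<le> t + n \<Longrightarrow> play a0 x s (mover t) = x t"
proof (induction s)
  case (Suc s)
  show ?case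
  proof (cases "s = t")
    case False
    then have "mover t \<noteq> mover s" using Suc.prems by (intro mover_neq) auto
    then show ?thesis using Suc False by simp
  qed simp
qed simp

lemma finite_move_seqs [simp]: "finite (move_seqs T)"
  by (auto simp: move_seqs_def intro: finite_PiE)

lemma restrict_in_move_seqs: "x \<in> move_seqs T \<Longrightarrow> t \<le> T \<Longrightarrow> restrict x {..<t} \<in> move_seqs t"
  by (auto simp: move_seqs_def PiE_iff)

lemma move_seqs_eqI:
  "x \<in> move_seqs T \<Longrightarrow> y \<in> move_seqs T \<Longrightarrow> (\<And>t. t < T \<Longrightarrow> x t = y t) \<Longrightarrow> x = y"
  unfolding move_seqs_def by (auto intro: PiE_ext)

lemma card_move_seqs: "card (move_seqs T) = (\<Prod>t<T. m (mover t))"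
  by (simp add: move_seqs_def card_PiE)

lemma card_move_seqs_pos: "0 < card (move_seqs T)"
  unfolding card_move_seqs using m_mover_pos by (intro prod_pos) simp

lemma card_move_seqs_split:
  "t \<le> T \<Longrightarrow> card (move_seqs T) = card (move_seqs t) * (\<Prod>s\<in>{t..<T}. m (mover s))"
  using prod.atLeastLessThan_concat[of 0 t T "\<lambda>s. m (mover s)"]
  by (simp add: card_move_seqs atLeast0LessThan)

lemma card_move_seqs_add_rounds:
  "card (move_seqs (t + k * n)) = card (move_seqs t) * card (profiles n m) ^ k"
proof (induction k)
  case (Suc k)
  let ?round = "{t + k * n..<t + k * n + n}"
  have "t + Suc k * n = t + k * n + n" by simp
  then have "card (move_seqs (t + Suc k * n)) =
      card (move_seqs (t + k * n)) * (\<Prod>s\<in>?round. m (mover s))"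
    by (metis card_move_seqs_split le_add1)
  also have "(\<Prod>s\<in>?round. m (mover s)) = card (profiles n m)"
    unfolding card_profiles by (rule prod.reindex_bij_betw[OF bij_betw_mover])
  finally show ?case unfolding Suc.IH by (simp only: power_Suc mult_ac)
qed simp

definition round_profiles :: "(nat \<Rightarrow> nat) \<Rightarrow> nat \<Rightarrow> nat \<Rightarrow> (nat \<Rightarrow> nat) \<Rightarrow> nat \<Rightarrow> (nat \<Rightarrow> nat)" where
  "round_profiles a0 t k x = (\<lambda>r\<in>{..<k}. play a0 x (t + Suc r * n))"

lemma ex_round:
  assumes "t \<le> s" "s < t + k * n"
  shows "\<exists>r<k. s < t + Suc r * n \<and> t + Suc r * n \<le> s + n"
proof -
  define r where "r = (s - t) div n"
  have "r < k" unfolding r_def using assms n_pos by (simp add: div_less_iff_less_mult)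
  moreover have "r * n \<le> s - t" "s - t < r * n + n"
    using dividend_less_div_times[OF n_pos, of "s - t"] by (auto simp: r_def)
  then have "s < t + Suc r * n" "t + Suc r * n \<le> s + n" using assms(1) by auto
  ultimately show ?thesis by blast
qed

text \<open>Every move of a round is still visible in the profile that ends it.\<close>
lemma inj_on_round_profiles:
  "inj_on (\<lambda>x. (restrict x {..<t}, round_profiles a0 t k x)) (move_seqs (t + k * n))"
proof (rule inj_onI)
  fix x y
  assume xy: "x \<in> move_seqs (t + k * n)" "y \<in> move_seqs (t + k * n)"
    and "(restrict x {..<t}, round_profiles a0 t k x) =
      (restrict y {..<t}, round_profiles a0 t k y)"
  then have eq_start: "restrict x {..<t} = restrict y {..<t}"
    and eq_rounds: "round_profiles a0 t k x = round_profiles a0 t k y"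
    unfolding prod.inject by blast+
  have "x s = y s" if s: "s < t + k * n" for s
  proof (cases "s < t")
    case True
    then show ?thesis using fun_cong[OF eq_start, of s] by simp
  next
    case False
    then obtain r where r: "r < k" "s < t + Suc r * n" "t + Suc r * n \<le> s + n"
      using ex_round[of t s k] s by auto
    have "x s = play a0 x (t + Suc r * n) (mover s)" "y s = play a0 y (t + Suc r * n) (mover s)"
      using r(2,3) by (simp_all only: play_last_move)
    moreover have "play a0 x (t + Suc r * n) = play a0 y (t + Suc r * n)"
      using fun_cong[OF eq_rounds, of r] r(1) by (simp add: round_profiles_def)
    ultimately show ?thesis by simp
  qed
  with xy show "x = y" by (rule move_seqs_eqI)
qed

lemma round_profiles_in_inj_seqs:
  assumes a0: "a0 \<in> profiles n m" and i: "i \<in> {1..n}" and T: "T = i - 1 + k * n"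
    and x: "x \<in> move_seqs T" "inj_on (visit a0 x) {..T}"
  shows "round_profiles a0 (i - 1) k x \<in> inj_seqs (profiles n m) (environment i) k"
proof -
  let ?time = "\<lambda>r. i - 1 + Suc r * n"
  have time_le: "?time r \<le> T" if "r < k" for r
    using that mult_le_mono1[of "Suc r" k n] by (simp add: T)
  have visit_time: "visit a0 x (?time r) = environment i (play a0 x (?time r))" for r
  proof -
    have "?time r mod n = i - 1" using i by (subst mod_mult_self1) auto
    then have "mover (?time r) = i" using i by (simp add: clockwork_def)
    then show ?thesis by (simp only: visit_def)
  qed
  have "inj_on (visit a0 x \<circ> ?time) {..<k}"
  proof (rule comp_inj_on)
    show "inj_on ?time {..<k}" using n_pos by (auto simp: inj_on_def)
    show "inj_on (visit a0 x) (?time ` {..<k})"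
      using x(2) time_le by (auto intro: inj_on_subset)
  qed
  then have "inj_on (environment i \<circ> round_profiles a0 (i - 1) k x) {..<k}"
    unfolding comp_def visit_time round_profiles_def by (rule inj_on_cong[THEN iffD1, rotated]) simp
  then show ?thesis
    using x(1) time_le a0 by (auto simp: inj_seqs_def round_profiles_def intro!: play_in_profiles)
qed

lemma card_inj_on_visit_le:
  assumes a0: "a0 \<in> profiles n m" and i: "i \<in> {1..n}" and T: "T = i - 1 + k * n"
  shows "card {x \<in> move_seqs T. inj_on (visit a0 x) {..T}} \<le>
    card (move_seqs T) * exp (- (m i * real (k choose 2) / card (profiles n m)))"
proof -
  let ?X = "{x \<in> move_seqs T. inj_on (visit a0 x) {..T}}"
  let ?rounds = "\<lambda>x. (restrict x {..<i - 1}, round_profiles a0 (i - 1) k x)"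
  let ?S = "inj_seqs (profiles n m) (environment i) k"
  have "card ?X \<le> card (move_seqs (i - 1) \<times> ?S)"
  proof (rule card_inj_on_le)
    show "inj_on ?rounds ?X"
      unfolding T by (rule inj_on_subset[OF inj_on_round_profiles]) auto
    show "?rounds ` ?X \<subseteq> move_seqs (i - 1) \<times> ?S"
      using round_profiles_in_inj_seqs[OF a0 i T] restrict_in_move_seqs by (auto simp: T)
    show "finite (move_seqs (i - 1) \<times> ?S)"
      by (intro finite_cartesian_product finite_inj_seqs) auto
  qed
  then have "real (card ?X) \<le> real (card (move_seqs (i - 1))) * card ?S"
    unfolding card_cartesian_product by (simp flip: of_nat_mult)
  also have "\<dots> \<le> real (card (move_seqs (i - 1))) *
      (real (card (profiles n m)) ^ k * exp (- (m i * real (k choose 2) / card (profiles n m))))"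
    using i by (intro mult_left_mono card_inj_seqs_le) (auto simp: card_profiles_environment)
  finally show ?thesis
    by (simp add: T card_move_seqs_add_rounds)
qed

lemma clock_dyn_PNE_absorbing:
  assumes "is_PNE n m U (clock_dyn n m U a0 s)"
  shows "clock_dyn n m U a0 (s + u) = clock_dyn n m U a0 s"
proof (induction u)
  case (Suc u)
  have "clock_dyn n m U a0 s (mover (s + u)) = best_resp m U (mover (s + u)) (clock_dyn n m U a0 s)"
    using assms mover_in by (simp only: is_PNE_def)
  then show ?case using Suc by (simp add: Let_def fun_upd_idem)
qed simp

lemma clock_dyn_periodic:
  assumes same_env: "environment (mover s) (clock_dyn n m U a0 s) =
      environment (mover t) (clock_dyn n m U a0 t)"
  shows "clock_dyn n m U a0 (Suc s + u) = clock_dyn n m U a0 (Suc t + u)"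
proof (induction u)
  case 0
  show ?case
    using environment_eq_fun_upd[OF same_env] best_resp_environment_cong[OF same_env, of m U]
    by (simp add: Let_def)
next
  case (Suc u)
  have "s mod n = t mod n"
    using same_env by (simp add: environment_def mover_eq_iff[symmetric])
  then have "(Suc s + u) mod n = (Suc t + u) mod n" by (metis mod_add_cong mod_Suc_eq)
  then have "mover (Suc s + u) = mover (Suc t + u)" by (simp only: mover_eq_iff)
  then show ?case using Suc by (simp only: add_Suc_right clock_dyn.simps Let_def)
qed

definition first_PNE :: "(nat \<times> (nat \<Rightarrow> nat) \<Rightarrow> real) \<Rightarrow> (nat \<Rightarrow> nat) \<Rightarrow> nat \<Rightarrow> bool" where
  "first_PNE U a0 t \<longleftrightarrow> 1 \<le> t \<and> is_PNE n m U (clock_dyn n m U a0 t) \<and>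
     (\<forall>s<t. 1 \<le> s \<longrightarrow> \<not> is_PNE n m U (clock_dyn n m U a0 s))"

lemma converges_PNE_iff_first_PNE: "converges_PNE n m U a0 \<longleftrightarrow> (\<exists>t. first_PNE U a0 t)"
  unfolding converges_PNE_def first_PNE_def
  using exists_least_iff[of "\<lambda>t. 1 \<le> t \<and> is_PNE n m U (clock_dyn n m U a0 t)"] by blast

lemma first_PNE_inj_on_visit:
  assumes "first_PNE U a0 t"
  shows "inj_on (visit a0 (best_moves U a0)) {..<t + n - 1}"
proof (rule linorder_inj_onI)
  have PNE: "is_PNE n m U (clock_dyn n m U a0 t)"
    and first: "\<And>s. 1 \<le> s \<Longrightarrow> s < t \<Longrightarrow> \<not> is_PNE n m U (clock_dyn n m U a0 s)"
    using assms by (auto simp: first_PNE_def)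
  fix r s assume rs: "r < s" "r \<in> {..<t + n - 1}" "s \<in> {..<t + n - 1}"
  show "visit a0 (best_moves U a0) r \<noteq> visit a0 (best_moves U a0) s"
  proof
    assume "visit a0 (best_moves U a0) r = visit a0 (best_moves U a0) s"
    then have same_env: "environment (mover r) (clock_dyn n m U a0 r) =
        environment (mover s) (clock_dyn n m U a0 s)"
      by (simp add: visit_def play_best_moves)
    then have "mover r = mover s" by (simp add: environment_def)
    then have round_apart: "r + n \<le> s" using mover_neq[of r s] rs(1) by linarith
    define u where "u = t - Suc s"
    have "clock_dyn n m U a0 (Suc r + u) = clock_dyn n m U a0 (Suc s + u)"
      by (rule clock_dyn_periodic[OF same_env])
    also have "\<dots> = clock_dyn n m U a0 t"
      using clock_dyn_PNE_absorbing[OF PNE, of "Suc s + u - t"] by (simp add: u_def)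
    finally have "is_PNE n m U (clock_dyn n m U a0 (Suc r + u))" using PNE by simp
    moreover have "Suc r + u < t" using rs round_apart n_pos by (auto simp: u_def)
    ultimately show False using first[of "Suc r + u"] by simp
  qed
qed auto

lemma first_PNE_best_moves:
  assumes "first_PNE U a0 t" "t \<le> s"
  shows "best_moves U a0 s = play a0 (best_moves U a0) t (mover s)"
proof -
  have PNE: "is_PNE n m U (clock_dyn n m U a0 t)" using assms(1) by (simp add: first_PNE_def)
  have "best_moves U a0 s = best_resp m U (mover s) (clock_dyn n m U a0 t)"
    using clock_dyn_PNE_absorbing[OF PNE, of "s - t"] assms(2) by (simp add: best_moves_def)
  also have "\<dots> = clock_dyn n m U a0 t (mover s)"
    using PNE mover_in by (simp only: is_PNE_def)
  finally show ?thesis by (simp only: play_best_moves)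
qed

lemma card_settled_move_seqs_le:
  assumes "t \<le> T"
  shows "card {x \<in> move_seqs T. \<forall>s\<in>{t..<T}. x s = play a0 x t (mover s)} \<le> card (move_seqs t)"
    (is "card ?X \<le> _")
proof (rule card_inj_on_le)
  show "inj_on (\<lambda>x. restrict x {..<t}) ?X"
  proof (rule inj_onI)
    fix x y assume xy: "x \<in> ?X" "y \<in> ?X" and eq: "restrict x {..<t} = restrict y {..<t}"
    have eq_start: "x s = y s" if "s < t" for s using fun_cong[OF eq, of s] that by simp
    then have "play a0 x t = play a0 y t" by (rule play_cong)
    then have "x s = y s" if "s < T" for s
      using that eq_start xy by (cases "s < t") auto
    with xy show "x = y" by (auto intro: move_seqs_eqI)
  qed
  show "(\<lambda>x. restrict x {..<t}) ` ?X \<subseteq> move_seqs t"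
    using assms by (auto intro: restrict_in_move_seqs)
qed simp

lemma best_moves_prefix_max:
  assumes prefix: "\<And>s. s \<le> t \<Longrightarrow> best_moves U a0 s = x s"
    and z: "z \<in> deviations m (mover t) (play a0 x t)"
  shows "U z \<le> U (mover t, play a0 x (Suc t))"
proof -
  have "play a0 x t = clock_dyn n m U a0 t"
    unfolding play_best_moves[symmetric] using prefix by (intro play_cong) simp
  then have "best_resp m U (mover t) (play a0 x t) = x t"
    using prefix[of t] by (simp add: best_moves_def)
  then show ?thesis
    using best_resp_max[of m "mover t" z "play a0 x t" U, OF m_mover_pos] z
    by (simp only: play.simps)
qed

lemma disjoint_family_on_deviations:
  "inj_on (visit a0 x) S \<Longrightarrow> disjoint_family_on (\<lambda>t. deviations m (mover t) (play a0 x t)) S"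
  unfolding disjoint_family_on_def by (auto intro!: disjoint_deviations simp: inj_on_def visit_def)

end

section \<open>The probability of convergence\<close>

locale random_clockwork_game = clockwork_game n m + atomless_distribution D
  for n :: nat and m :: "nat \<Rightarrow> nat" and D :: "real measure"
begin

abbreviation payoffs :: "(nat \<times> (nat \<Rightarrow> nat) \<Rightarrow> real) measure" where
  "payoffs \<equiv> iid (payoff_index n m)"

sublocale payoffs: prob_space payoffs
  by (rule prob_space_iid)

lemma measurable_payoff [measurable]: "(\<lambda>U. U z) \<in> borel_measurable payoffs"
proof (cases "z \<in> payoff_index n m")
  case True
  then have "(\<lambda>U. U z) \<in> payoffs \<rightarrow>\<^sub>M D" by measurable
  then show ?thesis using measurable_cong_sets[OF refl events_eq_borel] by blast
next
  case False
  then have "U z = undefined" if "U \<in> space payoffs" for U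
    using PiE_arb[of U "payoff_index n m" _ z] that by (simp add: space_PiM)
  then show ?thesis
    using measurable_cong[of payoffs "\<lambda>U. U z" "\<lambda>_. undefined" borel] by simp
qed

lemma pred_payoff_le [measurable]: "Measurable.pred payoffs (\<lambda>U. U z \<le> U z')"
  unfolding pred_def by (rule borel_measurable_le[OF measurable_payoff measurable_payoff])

lemma measurable_best_resp [measurable]:
  "(\<lambda>U. best_resp m U i a) \<in> payoffs \<rightarrow>\<^sub>M count_space UNIV"
  unfolding best_resp_def by measurable

abbreviation action_vectors :: "(nat \<Rightarrow> nat) set" where
  "action_vectors \<equiv> extensional {1..n}"

lemma countable_action_vectors: "countable action_vectors"
  using countable_PiE[of "{1..n}" "\<lambda>_. UNIV :: nat set"] by (simp add: PiE_def)

lemma profiles_subset_action_vectors: "profiles n m \<subseteq> action_vectors"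
  by (auto simp: profiles_def PiE_def)

lemma measurable_clock_dyn:
  assumes "a0 \<in> action_vectors"
  shows "(\<lambda>U. clock_dyn n m U a0 t) \<in> payoffs \<rightarrow>\<^sub>M count_space action_vectors"
proof (induction t)
  case (Suc t)
  have "(\<lambda>U. a(mover t := best_resp m U (mover t) a)) \<in> payoffs \<rightarrow>\<^sub>M count_space action_vectors"
    if "a \<in> action_vectors" for a
  proof -
    have "(\<lambda>x. a(mover t := x)) \<in> count_space UNIV \<rightarrow>\<^sub>M count_space action_vectors"
      using that mover_in by (auto simp: extensional_def)
    then show ?thesis by (rule measurable_compose[OF measurable_best_resp])
  qed
  then show ?case
    unfolding clock_dyn.simps Let_def
    by (rule measurable_compose_countable'[OF _ Suc countable_action_vectors])
qed (use assms in simp)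

lemma measurable_best_moves:
  assumes "a0 \<in> action_vectors"
  shows "(\<lambda>U. best_moves U a0 t) \<in> payoffs \<rightarrow>\<^sub>M count_space UNIV"
  unfolding best_moves_def
  using measurable_best_resp measurable_clock_dyn[OF assms] countable_action_vectors
  by (rule measurable_compose_countable')

lemma pred_first_PNE:
  assumes "a0 \<in> action_vectors"
  shows "Measurable.pred payoffs (\<lambda>U. first_PNE U a0 t)"
proof -
  have "Measurable.pred payoffs (\<lambda>U. is_PNE n m U a)" for a
    unfolding is_PNE_def by measurable
  then have [measurable]: "Measurable.pred payoffs (\<lambda>U. is_PNE n m U (clock_dyn n m U a0 s))" for s
    using measurable_clock_dyn[OF assms] countable_action_vectors
    by (rule measurable_compose_countable')
  show ?thesis unfolding first_PNE_def by measurable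
qed

lemma pred_converges_PNE:
  assumes "a0 \<in> action_vectors"
  shows "Measurable.pred payoffs (\<lambda>U. converges_PNE n m U a0)"
proof -
  note [measurable] = pred_first_PNE[OF assms]
  show ?thesis unfolding converges_PNE_iff_first_PNE by measurable
qed

lemma prob_best_moves_eq_le:
  assumes a0: "a0 \<in> profiles n m" and x: "x \<in> move_seqs T" and inj: "inj_on (visit a0 x) {..<T}"
  shows "\<P>(U in payoffs. \<forall>t<T. best_moves U a0 t = x t) \<le> 1 / card (move_seqs T)"
proof -
  define K where "K t = deviations m (mover t) (play a0 x t)" for t
  define v where "v t = (mover t, play a0 x (Suc t))" for t
  have [simp]: "finite (K t)" for t by (simp add: K_def)
  have "{U \<in> space payoffs. \<forall>t<T. best_moves U a0 t = x t} \<subseteq>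
      {U \<in> space payoffs. \<forall>t\<in>{..<T}. \<forall>z\<in>K t. U z \<le> U (v t)}"
    unfolding K_def v_def by (auto intro!: best_moves_prefix_max simp del: play.simps)
  moreover have "{U \<in> space payoffs. \<forall>t\<in>{..<T}. \<forall>z\<in>K t. U z \<le> U (v t)} \<in> sets payoffs"
    by measurable
  ultimately have "\<P>(U in payoffs. \<forall>t<T. best_moves U a0 t = x t) \<le>
      \<P>(U in payoffs. \<forall>t\<in>{..<T}. \<forall>z\<in>K t. U z \<le> U (v t))"
    by (rule payoffs.finite_measure_mono)
  also have "\<dots> = 1 / (\<Prod>t\<in>{..<T}. card (K t))"
  proof (rule prob_iid_disjoint_max)
    show "disjoint_family_on K {..<T}"
      unfolding K_def using inj by (rule disjoint_family_on_deviations)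
    fix t assume t: "t \<in> {..<T}"
    show "K t \<subseteq> payoff_index n m"
      unfolding K_def using t play_in_profiles[OF a0 x] mover_in
      by (intro deviations_subset_payoff_index) auto
    show "v t \<in> K t"
      using t x by (auto simp: K_def v_def deviations_def move_seqs_def PiE_iff)
  qed simp_all
  finally show ?thesis by (simp add: K_def card_deviations card_move_seqs)
qed

text \<open>The right-hand side is the probability of \<open>P\<close> under uniformly random moves.\<close>
lemma prob_best_moves_le:
  assumes a0: "a0 \<in> profiles n m"
    and Q_imp: "\<And>U. Q U \<Longrightarrow> P (best_moves U a0)"
    and P_inj: "\<And>x. P x \<Longrightarrow> inj_on (visit a0 x) {..<T}"
    and P_restrict: "\<And>x. P x \<Longrightarrow> P (restrict x {..<T})"
  shows "\<P>(U in payoffs. Q U) \<le> card {x \<in> move_seqs T. P x} / card (move_seqs T)"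
proof -
  let ?X = "{x \<in> move_seqs T. P x}"
  define plays where "plays x = {U \<in> space payoffs. \<forall>t<T. best_moves U a0 t = x t}" for x
  have [measurable]: "(\<lambda>U. best_moves U a0 t) \<in> payoffs \<rightarrow>\<^sub>M count_space UNIV" for t
    using a0 profiles_subset_action_vectors by (intro measurable_best_moves) auto
  have sets_plays: "plays x \<in> sets payoffs" for x
    unfolding plays_def by measurable
  have "{U \<in> space payoffs. Q U} \<subseteq> (\<Union>x\<in>?X. plays x)"
  proof
    fix U assume "U \<in> {U \<in> space payoffs. Q U}"
    then have "restrict (best_moves U a0) {..<T} \<in> ?X"
      and "U \<in> plays (restrict (best_moves U a0) {..<T})"
      using Q_imp P_restrict best_moves_in by (auto simp: plays_def move_seqs_def)
    then show "U \<in> (\<Union>x\<in>?X. plays x)" by blast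
  qed
  then have "\<P>(U in payoffs. Q U) \<le> measure payoffs (\<Union>x\<in>?X. plays x)"
    using sets_plays by (intro payoffs.finite_measure_mono) auto
  also have "\<dots> \<le> (\<Sum>x\<in>?X. measure payoffs (plays x))"
    using sets_plays by (intro payoffs.finite_measure_subadditive_finite) auto
  also have "\<dots> \<le> (\<Sum>x\<in>?X. 1 / card (move_seqs T))"
    unfolding plays_def using P_inj by (intro sum_mono prob_best_moves_eq_le a0) auto
  finally show ?thesis by simp
qed

lemma prob_first_PNE_le:
  assumes a0: "a0 \<in> profiles n m"
  shows "\<P>(U in payoffs. first_PNE U a0 t) \<le> 1 / q_nm n m"
proof -
  define T where "T = t + n - 1"
  have t_le: "t \<le> T" using n_pos by (simp add: T_def)
  define settled where "settled x \<longleftrightarrow> (\<forall>s\<in>{t..<T}. x s = play a0 x t (mover s))" for x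
  have "\<P>(U in payoffs. first_PNE U a0 t) \<le>
      card {x \<in> move_seqs T. inj_on (visit a0 x) {..<T} \<and> settled x} / card (move_seqs T)"
  proof (rule prob_best_moves_le[OF a0])
    fix U assume "first_PNE U a0 t"
    then show "inj_on (visit a0 (best_moves U a0)) {..<T} \<and> settled (best_moves U a0)"
      using first_PNE_inj_on_visit first_PNE_best_moves by (auto simp: T_def settled_def)
  next
    fix x assume "inj_on (visit a0 x) {..<T} \<and> settled x"
    then show "inj_on (visit a0 (restrict x {..<T})) {..<T} \<and> settled (restrict x {..<T})"
      using t_le
      by (subst inj_on_visit_restrict)
        (auto simp: settled_def restrict_apply' simp del: restrict_apply)
  qed blast
  also have "\<dots> \<le> card (move_seqs t) / card (move_seqs T)"
  proof -
    have "card {x \<in> move_seqs T. inj_on (visit a0 x) {..<T} \<and> settled x} \<le>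
        card {x \<in> move_seqs T. settled x}"
      by (intro card_mono) auto
    also have "\<dots> \<le> card (move_seqs t)"
      unfolding settled_def by (rule card_settled_move_seqs_le[OF t_le])
    finally show ?thesis by (simp add: divide_right_mono)
  qed
  also have "\<dots> = 1 / (\<Prod>s\<in>{t..<T}. real (m (mover s)))"
    using card_move_seqs_pos[of t] by (auto simp: card_move_seqs_split[OF t_le])
  also have "\<dots> \<le> 1 / q_nm n m"
    unfolding T_def using q_nm_pos q_nm_le_prod_mover by (rule frac_le[rotated 2]) auto
  finally show ?thesis .
qed

lemma prob_late_first_PNE_le:
  assumes a0: "a0 \<in> profiles n m"
    and i: "i \<in> {1..n}" "m i = Max (m ` {1..n})" and T: "T = i - 1 + k * n"
  shows "\<P>(U in payoffs. \<exists>t>T. first_PNE U a0 t) \<le> exp (- (real (k choose 2) / q_nm n m))"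
proof -
  have "\<P>(U in payoffs. \<exists>t>T. first_PNE U a0 t) \<le>
      card {x \<in> move_seqs T. inj_on (visit a0 x) {..T}} / card (move_seqs T)"
  proof (rule prob_best_moves_le[OF a0])
    fix U assume "\<exists>t>T. first_PNE U a0 t"
    then obtain t where t: "T < t" "first_PNE U a0 t" by blast
    show "inj_on (visit a0 (best_moves U a0)) {..T}"
      by (rule inj_on_subset[OF first_PNE_inj_on_visit[OF t(2)]]) (use t(1) n_pos in auto)
  qed (auto simp: inj_on_visit_restrict simp del: restrict_apply elim: inj_on_subset)
  also have "\<dots> \<le> exp (- (m i * real (k choose 2) / card (profiles n m)))"
    using card_inj_on_visit_le[OF a0 i(1) T] card_move_seqs_pos[of T]
    by (simp add: divide_le_eq mult.commute)
  also have "m i * real (k choose 2) / card (profiles n m) = real (k choose 2) / q_nm n m"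
    using m_pos[OF i(1)] unfolding q_nm_def card_profiles i(2)[symmetric] by simp
  finally show ?thesis .
qed

lemma prob_converges_PNE_le:
  assumes a0: "a0 \<in> profiles n m"
  shows "\<P>(U in payoffs. converges_PNE n m U a0) \<le>
    n * (real k + 1) / q_nm n m + exp (- (real (k choose 2) / q_nm n m))"
proof -
  obtain i where i: "i \<in> {1..n}" "m i = Max (m ` {1..n})"
    using ex_max_player[OF n_pos] by blast
  define T where "T = i - 1 + k * n"
  define first where "first t = {U \<in> space payoffs. first_PNE U a0 t}" for t
  define late where "late = {U \<in> space payoffs. \<exists>t>T. first_PNE U a0 t}"
  note [measurable] = pred_first_PNE[OF subsetD[OF profiles_subset_action_vectors a0]]
  have sets: "first t \<in> sets payoffs" "late \<in> sets payoffs" for t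
    unfolding first_def late_def by measurable
  have "t \<in> {1..T}" if "first_PNE U a0 t" "\<not> T < t" for U t
    using that by (simp add: first_PNE_def)
  then have "{U \<in> space payoffs. converges_PNE n m U a0} \<subseteq> (\<Union>t\<in>{1..T}. first t) \<union> late"
    unfolding converges_PNE_iff_first_PNE first_def late_def by blast
  then have "\<P>(U in payoffs. converges_PNE n m U a0) \<le>
      measure payoffs ((\<Union>t\<in>{1..T}. first t) \<union> late)"
    using sets by (intro payoffs.finite_measure_mono) auto
  also have "\<dots> \<le> measure payoffs (\<Union>t\<in>{1..T}. first t) + measure payoffs late"
    using sets by (intro measure_Un_le) auto
  also have "measure payoffs (\<Union>t\<in>{1..T}. first t) \<le> (\<Sum>t\<in>{1..T}. measure payoffs (first t))"
    using sets by (intro payoffs.finite_measure_subadditive_finite) auto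
  also have "\<dots> \<le> (\<Sum>t\<in>{1..T}. 1 / q_nm n m)"
    unfolding first_def by (intro sum_mono prob_first_PNE_le a0)
  also have "\<dots> \<le> n * (real k + 1) / q_nm n m"
  proof -
    have "T \<le> n * (k + 1)" using i(1) by (auto simp: T_def algebra_simps)
    then have "real T \<le> n * (real k + 1)"
      using of_nat_mono[of T "n * (k + 1)", where 'a = real] by (simp add: algebra_simps)
    then show ?thesis using q_nm_pos by (simp add: divide_right_mono)
  qed
  also have "measure payoffs late \<le> exp (- (real (k choose 2) / q_nm n m))"
    unfolding late_def by (rule prob_late_first_PNE_le[OF a0 i T_def])
  finally show ?thesis by simp
qed

lemma converges_PNE_imp_action_vector:
  assumes "converges_PNE n m U a0"
  shows "a0 \<in> action_vectors"
proof -
  obtain t where "clock_dyn n m U a0 t \<in> action_vectors"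
    using assms profiles_subset_action_vectors by (auto simp: converges_PNE_def is_PNE_def)
  moreover have "clock_dyn n m U a0 t j = a0 j" if "j \<notin> {1..n}" for j
    using that mover_in by (induction t) (auto simp: Let_def)
  ultimately show ?thesis by (auto simp: extensional_def)
qed

text \<open>The initial profile ranges over an uncountable type with the discrete sigma-algebra, but only
  countably many of its values can lead to a PNE.\<close>
lemma sets_conv_event: "conv_event n m D \<in> sets (game_space n m D)"
proof -
  have "conv_event n m D =
      (\<Union>a0\<in>action_vectors. {U \<in> space payoffs. converges_PNE n m U a0} \<times> {a0})"
    unfolding conv_event_def game_space_def space_pair_measure
    using converges_PNE_imp_action_vector by auto
  moreover have "{U \<in> space payoffs. converges_PNE n m U a0} \<in> sets payoffs"
    if "a0 \<in> action_vectors" for a0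
    using pred_converges_PNE[OF that] by (simp add: pred_def)
  ultimately show ?thesis
    unfolding game_space_def using countable_action_vectors
    by (auto intro!: sets.countable_UN' pair_measureI)
qed

lemma measure_conv_event_le:
  "measure (game_space n m D) (conv_event n m D) \<le>
    n * (real k + 1) / q_nm n m + exp (- (real (k choose 2) / q_nm n m))"
  unfolding game_space_def
proof (rule payoffs.measure_pair_pmf_le)
  show "conv_event n m D \<in> sets (payoffs \<Otimes>\<^sub>M measure_pmf (pmf_of_set (profiles n m)))"
    using sets_conv_event by (simp only: game_space_def)
  fix a0 assume "a0 \<in> set_pmf (pmf_of_set (profiles n m))"
  moreover have "profiles n m \<noteq> {}"
    using card_profiles[of n m] m_pos by fastforce
  ultimately have "a0 \<in> profiles n m" by simp
  then show "\<P>(U in payoffs. (U, a0) \<in> conv_event n m D) \<le>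
      n * (real k + 1) / q_nm n m + exp (- (real (k choose 2) / q_nm n m))"
    using prob_converges_PNE_le[of a0 k]
    by (simp add: conv_event_def game_space_def space_pair_measure cong: conj_cong)
qed

end

definition convergence_bound :: "real \<Rightarrow> real" where
  "convergence_bound q = (1 + log 2 q) * (q powr (2/3) + 3) / q + exp (- (q powr (1/3)) / 2)"

lemma convergence_bound_tendsto_0: "(convergence_bound \<longlongrightarrow> 0) at_top"
  unfolding convergence_bound_def by real_asymp

lemma real_choose_two: "real (k choose 2) = real k * (real k - 1) / 2"
  by (cases k) (simp_all add: choose_two real_of_nat_div algebra_simps)

lemma (in random_clockwork_game) measure_conv_event_le_convergence_bound:
  assumes "\<And>i. i \<in> {1..n} \<Longrightarrow> 2 \<le> m i"
  shows "measure (game_space n m D) (conv_event n m D) \<le> convergence_bound (q_nm n m)"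
proof -
  define q where "q = q_nm n m"
  have q_pos: "0 < q" unfolding q_def by (rule q_nm_pos)
  define k where "k = nat \<lceil>q powr (2/3)\<rceil> + 1"
  have k: "q powr (2/3) + 1 \<le> real k" "real k \<le> q powr (2/3) + 2"
    unfolding k_def using powr_ge_zero[of q "2/3"] by linarith+
  have "real n * (real k + 1) / q \<le> (1 + log 2 q) * (q powr (2/3) + 3) / q"
    using q_pos k le_log_q_nm[of n m, OF n_pos assms] unfolding q_def[symmetric]
    by (intro divide_right_mono mult_mono) auto
  moreover have "q powr (1/3) / 2 \<le> (k choose 2) / q"
  proof -
    have "q powr (1/3) * q = q powr (1/3) * q powr 1" using q_pos by simp
    also have "\<dots> = q powr (2/3) * q powr (2/3)"
      unfolding powr_add[symmetric] by simp
    also have "\<dots> \<le> real k * (real k - 1)"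
      using k powr_ge_zero[of q "2/3"] by (intro mult_mono) linarith+
    finally show ?thesis using q_pos by (simp add: real_choose_two field_simps)
  qed
  then have "exp (- (real (k choose 2) / q)) \<le> exp (- (q powr (1/3)) / 2)" by simp
  ultimately show ?thesis
    using measure_conv_event_le[of k] unfolding convergence_bound_def q_def by linarith
qed

theorem theorem1:
  fixes D :: "real measure" and \<epsilon> :: real
  assumes "prob_space D" and "sets D = sets borel"
    and "\<forall>x. emeasure D {x} = 0"
    and "\<epsilon> > 0"
  shows "\<exists>Q::real. \<forall>n::nat. \<forall>m::nat \<Rightarrow> nat.
           n \<ge> 2 \<longrightarrow> (\<forall>i\<in>{1..n}. m i \<ge> 2) \<longrightarrow> q_nm n m \<ge> Q \<longrightarrow>
           conv_event n m D \<in> sets (game_space n m D) \<and>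
           measure (game_space n m D) (conv_event n m D) < \<epsilon>"
proof -
  have "eventually (\<lambda>q. convergence_bound q < \<epsilon>) at_top"
    using convergence_bound_tendsto_0 \<open>\<epsilon> > 0\<close> by (rule order_tendstoD)
  then obtain Q where Q: "\<And>q. q \<ge> Q \<Longrightarrow> convergence_bound q < \<epsilon>"
    unfolding eventually_at_top_linorder by blast
  show ?thesis
  proof (intro exI[of _ Q] allI impI)
    fix n :: nat and m :: "nat \<Rightarrow> nat"
    assume n: "n \<ge> 2" and m: "\<forall>i\<in>{1..n}. m i \<ge> 2" and q: "q_nm n m \<ge> Q"
    interpret prob_space D by fact
    interpret random_clockwork_game n m D
      using n m assms by unfold_locales fastforce+
    have "measure (game_space n m D) (conv_event n m D) \<le> convergence_bound (q_nm n m)"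
      using m by (intro measure_conv_event_le_convergence_bound) auto
    also have "\<dots> < \<epsilon>" using q by (rule Q)
    finally show "conv_event n m D \<in> sets (game_space n m D) \<and>
        measure (game_space n m D) (conv_event n m D) < \<epsilon>"
      using sets_conv_event by simp
  qed
qed

end
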